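(* Let $\mathsf{L}^{\mathsf{A}}$ be a logic and $\mathsf{CS}$ a constant specification as in the context, where $\mathsf{CS}$ is axiomatically appropriate in case (jd) is in $\mathsf{L}^{\mathsf{A}}$. For every formula $F\in\mathcal{L}^{\mathsf{A}}_J$: if $\mathcal{M},\omega\Vdash F$ for all $\mathsf{L}^{\mathsf{A}}_{\mathsf{CS}}$-subset models $\mathcal{M}=(W,W_0,V,E)$ and all $\omega\in W_0$, then $\mathsf{L}^{\mathsf{A}}_{\mathsf{CS}}\vdash F$.
   Context: Terms $\mathsf{Tm}^{\mathsf{A}}$: $t::=c_i\mid x_i\mid (t\cdot t)\mid(t+t)\mid\ !t$. Formulas $\mathcal{L}^{\mathsf{A}}_J$: $F::=p_i\mid\bot\mid F\to F\mid t:F$. Axiom schemes: (cl) all classical propositional axioms; (j) $s:(A\to B)\to(t:A\to s\cdot t:B)$; (j+) $s:A\lor t:A\to(s+t):A$; (j4) $t:A\to\ !t:(t:A)$; (jd) $t:\bot\to\bot$; (jt) $t:A\to A$. A logic $\mathsf{L}^{\mathsf{A}}$: (cl),(j),(j+) plus some subset of $\{$(j4),(jd),(jt)$\}$. A constant specification $\mathsf{CS}$: set of pairs $(c,A)$, $c$ a constant, $A$ an axiom of $\mathsf{L}^{\mathsf{A}}$; axiomatically appropriate if each axiom $A$ has some $c$ with $(c,A)\in\mathsf{CS}$. $\mathsf{L}^{\mathsf{A}}_{\mathsf{CS}}$: Hilbert system with these axioms, modus ponens and axiom necessitation (for $(c,A)\in\mathsf{CS}$, $n\ge0$ infer $!^nc:\,!^{n-1}c:\cdots:\,!c:c:A$,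 $!^kc$ being $c$ preceded by $k$ copies of $!$). An $\mathsf{L}^{\mathsf{A}}_{\mathsf{CS}}$-subset model is $\mathcal{M}=(W,W_0,V,E)$ with $W$ a set, $\emptyset\ne W_0\subseteq W$, $V:W\times\mathcal{L}^{\mathsf{A}}_J\to\{0,1\}$, $E:W\times\mathsf{Tm}^{\mathsf{A}}\to\mathcal{P}(W)$ such that, with $[A]=\{\upsilon:V(\upsilon,A)=1\}$ and $\mathsf{APP}_\omega(s,t)=\{F:\exists H\,(E(\omega,s)\subseteq[H\to F]$ and $E(\omega,t)\subseteq[H])\}$, for all $\omega\in W_0$, $s,t$, $F,G$: $V(\omega,\bot)=0$; $V(\omega,F\to G)=1$ iff $V(\omega,F)=0$ or $V(\omega,G)=1$; $V(\omega,t:F)=1$ iff $E(\omega,t)\subseteq[F]$; $E(\omega,s\cdot t)\subseteq\{\upsilon:\upsilon\in[F]$ for all $F\in\mathsf{APP}_\omega(s,t)\}$; $E(\omega,s+t)\subseteq E(\omega,s)\cap E(\omega,t)$; if (jd)$\in\mathsf{L}^{\mathsf{A}}$ some $\upsilon\in W_0$ is in $E(\omega,t)$; if (jt)$\in\mathsf{L}^{\mathsf{A}}$ then $\omega\in E(\omega,t)$; if (j4)$\in\mathsf{L}^{\mathsf{A}}$ then $E(\omega,!t)\subseteq\{\upsilon:\forall F\,(V(\omega,t:F)=1\Rightarrow V(\upsilon,t:F)=1)\}$; for $(c,A)\in\mathsf{CS}$, $n\ge1$: $E(\omega,c)\subseteq[A]$ and $E(\omega,!^nc)\subseteq[!^{n-1}c:\cdots:\,!c:c:A]$.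 Truth: $\mathcal{M},\omega\Vdash F$ iff $V(\omega,F)=1$. *)

theory Defs
  imports Main
begin

section \<open>Syntax\<close>

datatype tm =
    Const nat
  | Var nat
  | App tm tm  (infixl \<open>\<^bold>\<cdot>\<close> 80)
  | Sum tm tm  (infixl \<open>\<^bold>+\<close> 75)
  | Bang tm    (\<open>\<^bold>!_\<close> [90] 90)

datatype fm =
    Prop nat
  | Falsum      (\<open>\<^bold>\<bottom>\<close>)
  | Imp fm fm   (infixr \<open>\<^bold>\<rightarrow>\<close> 60)
  | Just tm fm  (infixr \<open>\<^bold>:\<close> 70)

abbreviation Neg :: "fm \<Rightarrow> fm" (\<open>\<^bold>\<not>_\<close> [72] 72) where
  "\<^bold>\<not>A \<equiv> A \<^bold>\<rightarrow> \<^bold>\<bottom>"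

abbreviation Disj :: "fm \<Rightarrow> fm \<Rightarrow> fm" (infixr \<open>\<^bold>\<or>\<close> 65) where
  "A \<^bold>\<or> B \<equiv> \<^bold>\<not>A \<^bold>\<rightarrow> B"

text \<open>\<open>bang_chain n c A\<close> is \<open>!\<^sup>n c : !\<^sup>n\<^sup>-\<^sup>1 c : \<dots> : !c : c : A\<close>; in particular
  \<open>bang_chain 0 c A\<close> is \<open>c : A\<close>.\<close>

fun bang_chain :: "nat \<Rightarrow> nat \<Rightarrow> fm \<Rightarrow> fm" where
  "bang_chain 0 c A = Const c \<^bold>: A"
| "bang_chain (Suc n) c A = (Bang ^^ Suc n) (Const c) \<^bold>: bang_chain n c A"


section \<open>Justification logics\<close>

text \<open>A logic is determined by the set of those optional axiom schemes that it contains.\<close>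

datatype opt_scheme = J4 | JD | JT

type_synonym logic = "opt_scheme set"

text \<open>Classical propositional logic in \<open>\<rightarrow>\<close>, \<open>\<bottom>\<close> is axiomatized by the three
  usual Hilbert schemes, \<open>cl_k\<close>, \<open>cl_s\<close> and \<open>cl_dn\<close>.\<close>

inductive is_axiom :: "logic \<Rightarrow> fm \<Rightarrow> bool" for L :: logic where
  cl_k: "is_axiom L (A \<^bold>\<rightarrow> B \<^bold>\<rightarrow> A)"
| cl_s: "is_axiom L ((A \<^bold>\<rightarrow> B \<^bold>\<rightarrow> C) \<^bold>\<rightarrow> (A \<^bold>\<rightarrow> B) \<^bold>\<rightarrow> A \<^bold>\<rightarrow> C)"
| cl_dn: "is_axiom L (\<^bold>\<not>\<^bold>\<not>A \<^bold>\<rightarrow> A)"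
| j: "is_axiom L (s \<^bold>: (A \<^bold>\<rightarrow> B) \<^bold>\<rightarrow> (t \<^bold>: A \<^bold>\<rightarrow> (s \<^bold>\<cdot> t) \<^bold>: B))"
| j_plus: "is_axiom L ((s \<^bold>: A \<^bold>\<or> t \<^bold>: A) \<^bold>\<rightarrow> (s \<^bold>+ t) \<^bold>: A)"
| j4: "J4 \<in> L \<Longrightarrow> is_axiom L (t \<^bold>: A \<^bold>\<rightarrow> (\<^bold>!t) \<^bold>: (t \<^bold>: A))"
| jd: "JD \<in> L \<Longrightarrow> is_axiom L (t \<^bold>: \<^bold>\<bottom> \<^bold>\<rightarrow> \<^bold>\<bottom>)"
| jt: "JT \<in> L \<Longrightarrow> is_axiom L (t \<^bold>: A \<^bold>\<rightarrow> A)"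

text \<open>In a pair \<open>(c, A)\<close> of a constant specification, \<open>c\<close> is the index of a constant.\<close>

type_synonym const_spec = "(nat \<times> fm) set"

definition constant_specification :: "logic \<Rightarrow> const_spec \<Rightarrow> bool" where
  "constant_specification L CS \<longleftrightarrow> (\<forall>(c, A) \<in> CS. is_axiom L A)"

definition axiomatically_appropriate :: "logic \<Rightarrow> const_spec \<Rightarrow> bool" where
  "axiomatically_appropriate L CS \<longleftrightarrow> (\<forall>A. is_axiom L A \<longrightarrow> (\<exists>c. (c, A) \<in> CS))"

inductive derivable :: "logic \<Rightarrow> const_spec \<Rightarrow> fm \<Rightarrow> bool" (\<open>_, _ \<turnstile> _\<close> [50, 50, 50] 50)
  for L :: logic and CS :: const_spec where
  axiom: "is_axiom L A \<Longrightarrow> L, CS \<turnstile> A"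
| modus_ponens: "L, CS \<turnstile> A \<^bold>\<rightarrow> B \<Longrightarrow> L, CS \<turnstile> A \<Longrightarrow> L, CS \<turnstile> B"
| axiom_necessitation: "(c, A) \<in> CS \<Longrightarrow> L, CS \<turnstile> bang_chain n c A"


section \<open>Subset models\<close>

text \<open>The truth values \<open>1\<close> and \<open>0\<close> are rendered as \<open>True\<close> and \<open>False\<close>. The values of
  \<open>V\<close> and \<open>E\<close> at points outside \<open>W\<close> are irrelevant.\<close>

record 'w subset_structure =
  W :: "'w set"
  W0 :: "'w set"
  V :: "'w \<Rightarrow> fm \<Rightarrow> bool"
  E :: "'w \<Rightarrow> tm \<Rightarrow> 'w set"

definition truth_set :: "'w subset_structure \<Rightarrow> fm \<Rightarrow> 'w set" where
  "truth_set M A = {v \<in> W M. V M v A}"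

definition APP :: "'w subset_structure \<Rightarrow> 'w \<Rightarrow> tm \<Rightarrow> tm \<Rightarrow> fm set" where
  "APP M w s t =
     {F. \<exists>H. E M w s \<subseteq> truth_set M (H \<^bold>\<rightarrow> F) \<and> E M w t \<subseteq> truth_set M H}"

definition subset_model :: "logic \<Rightarrow> const_spec \<Rightarrow> 'w subset_structure \<Rightarrow> bool" where
  "subset_model L CS M \<longleftrightarrow>
     W0 M \<noteq> {} \<and> W0 M \<subseteq> W M \<and>
     (\<forall>w \<in> W M. \<forall>t. E M w t \<subseteq> W M) \<and>
     (\<forall>w \<in> W0 M.
        \<not> V M w \<^bold>\<bottom> \<and>
        (\<forall>F G. V M w (F \<^bold>\<rightarrow> G) \<longleftrightarrow> \<not> V M w F \<or> V M w G) \<and>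
        (\<forall>t F. V M w (t \<^bold>: F) \<longleftrightarrow> E M w t \<subseteq> truth_set M F) \<and>
        (\<forall>s t. E M w (s \<^bold>\<cdot> t) \<subseteq> {v \<in> W M. \<forall>F \<in> APP M w s t. v \<in> truth_set M F}) \<and>
        (\<forall>s t. E M w (s \<^bold>+ t) \<subseteq> E M w s \<inter> E M w t) \<and>
        (JD \<in> L \<longrightarrow> (\<forall>t. \<exists>v \<in> W0 M. v \<in> E M w t)) \<and>
        (JT \<in> L \<longrightarrow> (\<forall>t. w \<in> E M w t)) \<and>
        (J4 \<in> L \<longrightarrow>
          (\<forall>t. E M w (\<^bold>!t) \<subseteq> {v \<in> W M. \<forall>F. V M w (t \<^bold>: F) \<longrightarrow> V M v (t \<^bold>: F)})) \<and>
        (\<forall>(c, A) \<in> CS.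
          E M w (Const c) \<subseteq> truth_set M A \<and>
          (\<forall>n \<ge> 1. E M w ((Bang ^^ n) (Const c)) \<subseteq> truth_set M (bang_chain (n - 1) c A))))"

definition forces :: "'w subset_structure \<Rightarrow> 'w \<Rightarrow> fm \<Rightarrow> bool" (\<open>_, _ \<tturnstile> _\<close> [50, 50, 50] 50) where
  "M, w \<tturnstile> F \<longleftrightarrow> V M w F"

text \<open>
  A HOL formula cannot quantify over all carrier types, so validity of a formula in all subset
  models has to be stated for worlds of a fixed type. Completeness is stated for worlds of type
  \<open>fm set\<close>: as validity is the hypothesis there, asking for it only over this type (hence only
  for models of at most continuum size) makes the theorem at least as strong as one asking for
  validity over arbitrary sets of worlds.
\<close>

end

(* Canonical model: the worlds are all sets of formulas, the normal worlds W0 are the maximal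
   consistent ones, and E w t consists of the sets that contain every F with t : F in w.
   Since worlds outside W0 are arbitrary sets, {F. t : F in w} is itself a world in E w t, so
   E w t is contained in the truth set of F only if t : F is in w. Under (jd) some world of E w t must
   be maximal consistent; this holds because, by internalization, a contradiction derived from
   {F. t : F in w} would put s : Falsum into w for some term s. *)
theory Submission
  imports Defs
begin

text \<open>Theorems are leaves and only modus ponens combines formulas, so the deduction theorem
  needs no case for axiom necessitation, and premises need not be collected in finite lists.\<close>

inductive entails :: "logic \<Rightarrow> const_spec \<Rightarrow> fm set \<Rightarrow> fm \<Rightarrow> bool"
  for L :: logic and CS :: const_spec and \<Gamma> :: "fm set" where
  derived: "L, CS \<turnstile> A \<Longrightarrow> entails L CS \<Gamma> A"
| hyp: "A \<in> \<Gamma> \<Longrightarrow> entails L CS \<Gamma> A"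
| mp: "entails L CS \<Gamma> (A \<^bold>\<rightarrow> B) \<Longrightarrow> entails L CS \<Gamma> A \<Longrightarrow> entails L CS \<Gamma> B"

lemma entails_axiom: "is_axiom L A \<Longrightarrow> entails L CS \<Gamma> A"
  by (intro entails.derived derivable.axiom)

lemma entails_mono:
  assumes "entails L CS \<Gamma> A" "\<Gamma> \<subseteq> \<Delta>"
  shows "entails L CS \<Delta> A"
  using assms by (induction rule: entails.induct) (auto intro: entails.intros)

lemma entails_weaken:
  assumes "entails L CS \<Gamma> B"
  shows "entails L CS \<Gamma> (A \<^bold>\<rightarrow> B)"
  using entails.mp[OF entails_axiom[OF is_axiom.cl_k] assms] .

text \<open>The combinator derivation S K K, with \<open>cl_s\<close> taken at the middle formula
  \<open>A\<close> implies \<open>A\<close>.\<close>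

lemma entails_refl: "entails L CS \<Gamma> (A \<^bold>\<rightarrow> A)"
  using entails.mp[OF entails.mp[OF entails_axiom[OF is_axiom.cl_s]
      entails_axiom[OF is_axiom.cl_k]] entails_axiom[OF is_axiom.cl_k[of _ A A]]] .

lemma entails_deduction:
  assumes "entails L CS (insert A \<Gamma>) B"
  shows "entails L CS \<Gamma> (A \<^bold>\<rightarrow> B)"
  using assms
proof (induction rule: entails.induct)
  case (derived B)
  then show ?case by (intro entails_weaken entails.derived)
next
  case (hyp B)
  then show ?case by (auto intro: entails_weaken entails_refl entails.hyp)
next
  case (mp B C)
  show ?case
    using entails.mp[OF entails.mp[OF entails_axiom[OF is_axiom.cl_s] mp.IH(1)] mp.IH(2)] .
qed

lemma entails_empty: "entails L CS {} A \<Longrightarrow> L, CS \<turnstile> A"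
  by (induction rule: entails.induct) (auto intro: derivable.modus_ponens)

text \<open>Compactness along a chain: at modus ponens the members that entail the two premises are
  comparable, so the larger one entails both. Nonemptiness supplies a member when a theorem is
  used.\<close>

lemma entails_chain_Union:
  assumes "entails L CS (\<Union>\<C>) A" "subset.chain \<A> \<C>" "\<C> \<noteq> {}"
  shows "\<exists>\<Gamma>\<in>\<C>. entails L CS \<Gamma> A"
  using assms
proof (induction rule: entails.induct)
  case (derived A)
  then show ?case by (auto intro: entails.derived)
next
  case (hyp A)
  then show ?case by (auto intro: entails.hyp)
next
  case (mp A B)
  then obtain \<Gamma> \<Delta> where "\<Gamma> \<in> \<C>" "entails L CS \<Gamma> (A \<^bold>\<rightarrow> B)" "\<Delta> \<in> \<C>" "entails L CS \<Delta> A"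
    by blast
  moreover from this have "\<Gamma> \<subseteq> \<Delta> \<or> \<Delta> \<subseteq> \<Gamma>"
    using mp.prems by (auto simp: subset.chain_def)
  ultimately show ?case by (metis entails.mp entails_mono)
qed

text \<open>Weakening falsum by the negation of \<open>A\<close> yields the double negation of
  \<open>A\<close>.\<close>

lemma entails_explosion: "entails L CS \<Gamma> \<^bold>\<bottom> \<Longrightarrow> entails L CS \<Gamma> A"
  using entails.mp[OF entails_axiom[OF is_axiom.cl_dn] entails_weaken] .

definition consistent :: "logic \<Rightarrow> const_spec \<Rightarrow> fm set \<Rightarrow> bool" where
  "consistent L CS \<Gamma> \<longleftrightarrow> \<not> entails L CS \<Gamma> \<^bold>\<bottom>"

definition max_consistent :: "logic \<Rightarrow> const_spec \<Rightarrow> fm set \<Rightarrow> bool" where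
  "max_consistent L CS w \<longleftrightarrow>
     consistent L CS w \<and> (\<forall>\<Gamma>. consistent L CS \<Gamma> \<longrightarrow> w \<subseteq> \<Gamma> \<longrightarrow> \<Gamma> = w)"

lemma lindenbaum:
  assumes "consistent L CS \<Gamma>"
  obtains w where "max_consistent L CS w" "\<Gamma> \<subseteq> w"
proof -
  let ?\<A> = "{\<Delta>. consistent L CS \<Delta> \<and> \<Gamma> \<subseteq> \<Delta>}"
  have "\<exists>M\<in>?\<A>. \<forall>X\<in>?\<A>. M \<subseteq> X \<longrightarrow> X = M"
  proof (rule subset_Zorn_nonempty)
    show "?\<A> \<noteq> {}" using assms by blast
  next
    fix \<C> assume \<C>: "\<C> \<noteq> {}" "subset.chain ?\<A> \<C>"
    then have "\<C> \<subseteq> ?\<A>" by (simp add: subset.chain_def)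
    with \<C> show "\<Union>\<C> \<in> ?\<A>"
      using entails_chain_Union[OF _ \<C>(2,1)] by (fastforce simp: consistent_def)
  qed
  \<comment> \<open>Maximality inside \<open>?\<A>\<close> is maximality among all consistent sets,
    because every superset of \<open>w\<close> contains \<open>\<Gamma>\<close>.\<close>
  then obtain w where "consistent L CS w" "\<Gamma> \<subseteq> w"
    and "\<And>\<Delta>. consistent L CS \<Delta> \<Longrightarrow> w \<subseteq> \<Delta> \<Longrightarrow> \<Delta> = w"
    by (auto intro: order_trans)
  then show thesis by (intro that[of w]) (auto simp: max_consistent_def)
qed

lemma max_consistent_neg:
  assumes "max_consistent L CS w" "A \<notin> w"
  shows "entails L CS w (\<^bold>\<not>A)"
proof -
  have "\<not> consistent L CS (insert A w)"
    using assms by (auto simp: max_consistent_def)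
  then show ?thesis by (simp add: consistent_def entails_deduction)
qed

text \<open>If \<open>A\<close> were entailed but missing, its negation would be entailed as well,
  against consistency.\<close>

lemma max_consistent_closed:
  assumes "max_consistent L CS w"
  shows "A \<in> w \<longleftrightarrow> entails L CS w A"
  using assms max_consistent_neg[OF assms] entails.mp[of L CS w A "\<^bold>\<bottom>"]
  by (auto simp: max_consistent_def consistent_def intro: entails.hyp)

lemma max_consistent_imp:
  assumes "max_consistent L CS w"
  shows "(A \<^bold>\<rightarrow> B) \<in> w \<longleftrightarrow> A \<notin> w \<or> B \<in> w"
proof -
  have "entails L CS w (A \<^bold>\<rightarrow> B)" if "A \<notin> w"
  proof (rule entails_deduction, rule entails_explosion)
    have "entails L CS (insert A w) (\<^bold>\<not>A)"
      using max_consistent_neg[OF assms that] by (rule entails_mono) blast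
    then show "entails L CS (insert A w) \<^bold>\<bottom>"
      by (rule entails.mp) (simp add: entails.hyp)
  qed
  then show ?thesis
    using max_consistent_closed[OF assms] by (metis entails.mp entails_weaken)
qed

lemma max_consistent_derivable:
  "max_consistent L CS w \<Longrightarrow> L, CS \<turnstile> A \<Longrightarrow> A \<in> w"
  by (simp add: max_consistent_closed entails.derived)

lemma max_consistent_axiom_imp:
  "max_consistent L CS w \<Longrightarrow> is_axiom L (A \<^bold>\<rightarrow> B) \<Longrightarrow> A \<in> w \<Longrightarrow> B \<in> w"
  using max_consistent_derivable[OF _ derivable.axiom] max_consistent_imp by blast

lemma max_consistent_falsum: "max_consistent L CS w \<Longrightarrow> \<^bold>\<bottom> \<notin> w"
  by (auto simp: max_consistent_def consistent_def intro: entails.hyp)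

lemma max_consistent_app:
  assumes "max_consistent L CS w" "s \<^bold>: (A \<^bold>\<rightarrow> B) \<in> w" "t \<^bold>: A \<in> w"
  shows "(s \<^bold>\<cdot> t) \<^bold>: B \<in> w"
  using assms max_consistent_axiom_imp[OF _ is_axiom.j] max_consistent_imp by blast

text \<open>The disjunction in \<open>j_plus\<close> abbreviates an implication from a negation;
  since falsum is not in \<open>w\<close>, reading both implications in \<open>w\<close> gives an
  ordinary disjunction.\<close>

lemma max_consistent_sum:
  assumes "max_consistent L CS w" "s \<^bold>: A \<in> w \<or> t \<^bold>: A \<in> w"
  shows "(s \<^bold>+ t) \<^bold>: A \<in> w"
  using max_consistent_axiom_imp[OF assms(1) is_axiom.j_plus] assms(2)
    max_consistent_imp[OF assms(1)] max_consistent_falsum[OF assms(1)] by blast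

text \<open>The term mirrors the derivation: a constant for an axiom, an application for modus
  ponens, and one more bang for a chain given by axiom necessitation.\<close>

lemma internalization:
  assumes "L, CS \<turnstile> A" "axiomatically_appropriate L CS"
  shows "\<exists>t. L, CS \<turnstile> t \<^bold>: A"
  using assms
proof (induction rule: derivable.induct)
  case (axiom A)
  then show ?case
    by (metis axiomatically_appropriate_def bang_chain.simps(1) derivable.axiom_necessitation)
next
  case (modus_ponens A B)
  then show ?case by (meson is_axiom.j derivable.axiom derivable.modus_ponens)
next
  case (axiom_necessitation c A n)
  then show ?case by (metis bang_chain.simps(2) derivable.axiom_necessitation)
qed

text \<open>A hypothesis is justified by \<open>t\<close> itself and a theorem by its internalizing
  term; modus ponens applies one term to the other. With falsum for \<open>A\<close>, this
  contradicts \<open>jd\<close>.\<close>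

lemma entails_justified:
  assumes "entails L CS {F. t \<^bold>: F \<in> w} A"
    and "max_consistent L CS w" "axiomatically_appropriate L CS"
  shows "\<exists>s. s \<^bold>: A \<in> w"
  using assms
proof (induction rule: entails.induct)
  case (derived A)
  then show ?case using internalization max_consistent_derivable by blast
next
  case (hyp A)
  then show ?case by blast
next
  case (mp A B)
  then show ?case using max_consistent_app by blast
qed

definition canonical_model :: "logic \<Rightarrow> const_spec \<Rightarrow> fm set subset_structure" where
  "canonical_model L CS =
     \<lparr>W = UNIV, W0 = {w. max_consistent L CS w}, V = (\<lambda>w F. F \<in> w),
      E = (\<lambda>w t. {v. \<forall>F. t \<^bold>: F \<in> w \<longrightarrow> F \<in> v})\<rparr>"

lemma canonical_model_simps [simp]:
  "W (canonical_model L CS) = UNIV"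
  "W0 (canonical_model L CS) = {w. max_consistent L CS w}"
  "V (canonical_model L CS) w F \<longleftrightarrow> F \<in> w"
  "E (canonical_model L CS) w t = {v. \<forall>F. t \<^bold>: F \<in> w \<longrightarrow> F \<in> v}"
  "truth_set (canonical_model L CS) F = {v. F \<in> v}"
  by (simp_all add: canonical_model_def truth_set_def)

lemma canonical_just:
  "{v. \<forall>F. t \<^bold>: F \<in> w \<longrightarrow> F \<in> v} \<subseteq> {v. A \<in> v} \<longleftrightarrow> t \<^bold>: A \<in> w"
proof
  assume "{v. \<forall>F. t \<^bold>: F \<in> w \<longrightarrow> F \<in> v} \<subseteq> {v. A \<in> v}"
  then have "{F. t \<^bold>: F \<in> w} \<in> {v. A \<in> v}" by blast
  then show "t \<^bold>: A \<in> w" by simp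
qed blast

lemma canonical_model_serial:
  assumes w: "max_consistent L CS w" and "JD \<in> L" "axiomatically_appropriate L CS"
  shows "\<exists>v. max_consistent L CS v \<and> (\<forall>F. t \<^bold>: F \<in> w \<longrightarrow> F \<in> v)"
proof -
  have "consistent L CS {F. t \<^bold>: F \<in> w}"
    unfolding consistent_def
    using entails_justified[OF _ w] max_consistent_axiom_imp[OF w is_axiom.jd]
      max_consistent_falsum[OF w] assms(2,3) by blast
  then show ?thesis by (rule lindenbaum) blast
qed

text \<open>The first assumption is what makes \<open>W0\<close> nonempty.\<close>

lemma canonical_subset_model:
  assumes "\<exists>w. max_consistent L CS w"
    and "JD \<in> L \<Longrightarrow> axiomatically_appropriate L CS"
  shows "subset_model L CS (canonical_model L CS)"
proof -
  let ?M = "canonical_model L CS"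
  {
    fix w assume w: "max_consistent L CS w"
    note falsum = max_consistent_falsum[OF w]
    note imp = max_consistent_imp[OF w]
    \<comment> \<open>By \<open>canonical_just\<close>, the two inclusions in \<open>APP\<close> say
      that \<open>s\<close> justifies \<open>H\<close> implies \<open>F\<close>, and
      \<open>t\<close> justifies \<open>H\<close>, in \<open>w\<close>; then \<open>s\<close>
      applied to \<open>t\<close> justifies \<open>F\<close> there.\<close>
    have app: "E ?M w (s \<^bold>\<cdot> t) \<subseteq> {v \<in> W ?M. \<forall>F \<in> APP ?M w s t. v \<in> truth_set ?M F}" for s t
      using max_consistent_app[OF w] by (auto simp: APP_def canonical_just)
    \<comment> \<open>The more formulas a term justifies in \<open>w\<close>, the fewer worlds lie
      in its \<open>E\<close>-set.\<close>
    have sum: "E ?M w (s \<^bold>+ t) \<subseteq> E ?M w s \<inter> E ?M w t" for s t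
      using max_consistent_sum[OF w] by auto
    have jd: "\<exists>v \<in> W0 ?M. v \<in> E ?M w t" if "JD \<in> L" for t
      using canonical_model_serial[OF w that assms(2)[OF that]] by auto
    have jt: "w \<in> E ?M w t" if "JT \<in> L" for t
      using max_consistent_axiom_imp[OF w is_axiom.jt[OF that]] by auto
    \<comment> \<open>The world \<open>v\<close> may be an arbitrary set, but \<open>V\<close> is
      mere membership, so it suffices that the bang of \<open>t\<close> justifies the whole formula
      in which \<open>t\<close> justifies \<open>F\<close>.\<close>
    have j4: "E ?M w (\<^bold>!t) \<subseteq> {v \<in> W ?M. \<forall>F. V ?M w (t \<^bold>: F) \<longrightarrow> V ?M v (t \<^bold>: F)}"
      if "J4 \<in> L" for t
      using max_consistent_axiom_imp[OF w is_axiom.j4[OF that]] by auto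
    have chain: "bang_chain n c A \<in> w" if "(c, A) \<in> CS" for n c A
      using max_consistent_derivable[OF w] derivable.axiom_necessitation[OF that] by blast
    have const: "E ?M w (Const c) \<subseteq> truth_set ?M A" if "(c, A) \<in> CS" for c A
      using chain[OF that, of 0] by auto
    \<comment> \<open>For positive \<open>n\<close>, the chain of index \<open>n\<close> in
      \<open>w\<close> is the \<open>n\<close>-fold bang of \<open>c\<close> justifying the chain of
      index \<open>n - 1\<close>.\<close>
    have bang: "E ?M w ((Bang ^^ n) (Const c)) \<subseteq> truth_set ?M (bang_chain (n - 1) c A)"
      if "(c, A) \<in> CS" "n \<ge> 1" for c A n
      using chain[OF that(1), of n] that(2) by (cases n) auto
    note falsum imp app sum jd jt j4 const bang
  }
  note world = this
  show ?thesis
    unfolding subset_model_def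
    using assms(1) world(3-9)
    by (intro conjI ballI allI impI)
      (auto simp: max_consistent_falsum max_consistent_imp canonical_just simp del: bang_chain.simps)
qed

theorem mainTheorem11:
  fixes L :: logic and CS :: const_spec and F :: fm
  assumes "constant_specification L CS"
    and "JD \<in> L \<Longrightarrow> axiomatically_appropriate L CS"
    and "\<And>(M :: fm set subset_structure) w.
           subset_model L CS M \<Longrightarrow> w \<in> W0 M \<Longrightarrow> M, w \<tturnstile> F"
  shows "L, CS \<turnstile> F"
proof (rule ccontr)
  assume "\<not> L, CS \<turnstile> F"
  \<comment> \<open>Deduction gives the double negation of \<open>F\<close>, which
    \<open>cl_dn\<close> removes.\<close>
  moreover have "L, CS \<turnstile> F" if "entails L CS {\<^bold>\<not>F} \<^bold>\<bottom>"
    using entails_empty[OF entails_deduction[OF that]]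
    by (rule derivable.modus_ponens[OF derivable.axiom[OF is_axiom.cl_dn]])
  ultimately have "consistent L CS {\<^bold>\<not>F}"
    by (auto simp: consistent_def)
  then obtain w where w: "max_consistent L CS w" and "\<^bold>\<not>F \<in> w"
    by (rule lindenbaum) blast
  then have "F \<notin> w"
    by (simp add: max_consistent_imp max_consistent_falsum)
  \<comment> \<open>The same \<open>w\<close> also witnesses that a maximal consistent set
    exists.\<close>
  moreover have "canonical_model L CS, w \<tturnstile> F"
    using w assms(2) by (intro assms(3) canonical_subset_model) auto
  ultimately show False
    by (simp add: forces_def)
qed

end
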